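(* Let $f,g,s,t\geq 1$ be integers and let $n(\cdot,\cdot,\cdot,\cdot)$ be a function as described in the context. Let $n_1=n(f,2g+1,s,t)$ and $n_2=n(2g,2,s,t)$. Let $G$ be a $(K_{s,s},K_t)$-free graph, let $z_1,z_2\in V(G)$ be adjacent, and let $\mathfrak{c}=(\Lambda_{1,z},z,\Lambda_{2,z}:z\in\Lambda)$ be a $(z_1,z_2,n_1,n_2)$-crystal in $G$. Then there is a clear $(z_1,z_2,f,g)$-crystal in $G$.
   Context: Graphs are finite and simple; $G$ is $X$-free if no induced subgraph is isomorphic to $X$. Sets $X,Y$ of vertices are anticomplete if there is no edge between them. $n(q,r,s,t)$ denotes a positive integer (which exists for all integers $q,r,s,t\geq1$) with the property: for every $(K_{s,s},K_t)$-free graph $G$ and every collection $\mathcal{X}$ of at least $n(q,r,s,t)$ pairwise disjoint subsets of $V(G)$ each of cardinality at most $r$, there are $q$ distinct members of $\mathcal{X}$ that are pairwise anticomplete in $G$. For integers $f,g\geq1$ and adjacent $z_1,z_2\in V(G)$, a $(z_1,z_2,f,g)$-crystal in $G$ is a tuple $(S_{1,z},z,S_{2,z}:z\in S)$ such that: $S$ is an $f$-element subset of $V(G)\setminus\{z_1,z_2\}$; the $2f$ sets $S_{1,z},S_{2,z}$ ($z\in S$) are pairwise disjoint $g$-element subsets of $V(G)\setminus(S\cup\{z_1,z_2\})$; and for each $i\in\{1,2\}$, each $z\in S$ and each $x\in S_{i,z}$, the set of neighbors of $x$ in $\{z_1,z_2,z\}$ is exactly $\{z_i,z\}$. Such a crystal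 is clear if $S$ is a stable set and the sets $S_{1,z},S_{2,z}$ ($z\in S$) are stable sets that are pairwise anticomplete. *)

theory Defs
  imports "Graph_Theory.Kuratowski" "HOL-Library.Disjoint_Sets"
begin

text \<open>
  Finite simple graphs are the \<open>graph\<close> locale of Graph_Theory (symmetric digraphs without loops and
  multiple arcs); adjacency is \<open>u \<rightarrow>\<^bsub>G\<^esub> v\<close>. In the following definition an isomorphism type is given
  by the predicate of being a graph of that type, as for the library's \<open>K\<^bsub>t\<^esub>\<close> and \<open>K\<^bsub>s,s\<^esub>\<close>.
\<close>

definition induced_free :: "(('a, 'b) pre_digraph \<Rightarrow> bool) \<Rightarrow> ('a, 'b) pre_digraph \<Rightarrow> bool" where
  "induced_free X G \<longleftrightarrow> \<not> (\<exists>H. induced_subgraph H G \<and> X H)"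

definition anticomplete :: "('a, 'b) pre_digraph \<Rightarrow> 'a set \<Rightarrow> 'a set \<Rightarrow> bool" where
  "anticomplete G X Y \<longleftrightarrow> (\<forall>x\<in>X. \<forall>y\<in>Y. \<not> x \<rightarrow>\<^bsub>G\<^esub> y)"

definition stable :: "('a, 'b) pre_digraph \<Rightarrow> 'a set \<Rightarrow> bool" where
  "stable G X \<longleftrightarrow> (\<forall>x\<in>X. \<forall>y\<in>X. \<not> x \<rightarrow>\<^bsub>G\<^esub> y)"

definition neighbors :: "('a, 'b) pre_digraph \<Rightarrow> 'a \<Rightarrow> 'a set" where
  "neighbors G x = {y. x \<rightarrow>\<^bsub>G\<^esub> y}"

text \<open>
  A crystal \<open>(S\<^sub>1\<^sub>,\<^sub>z, z, S\<^sub>2\<^sub>,\<^sub>z : z \<in> S)\<close> is given by \<open>S\<close> and the functions \<open>S1\<close>, \<open>S2\<close>, whose values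
  outside \<open>S\<close> are irrelevant. The family of the \<open>2f\<close> sets is indexed by the disjoint sum \<open>S <+> S\<close>, with
  \<open>Inl z\<close> and \<open>Inr z\<close> standing for the indices \<open>1,z\<close> and \<open>2,z\<close>.
\<close>

definition crystal ::
  "('a, 'b) pre_digraph \<Rightarrow> 'a \<Rightarrow> 'a \<Rightarrow> nat \<Rightarrow> nat \<Rightarrow> 'a set \<Rightarrow> ('a \<Rightarrow> 'a set) \<Rightarrow> ('a \<Rightarrow> 'a set) \<Rightarrow> bool"
where
  "crystal G z1 z2 f g S S1 S2 \<longleftrightarrow>
     S \<subseteq> verts G - {z1, z2} \<and> card S = f \<and>
     (\<forall>z\<in>S. S1 z \<subseteq> verts G - (S \<union> {z1, z2}) \<and> card (S1 z) = g) \<and>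
     (\<forall>z\<in>S. S2 z \<subseteq> verts G - (S \<union> {z1, z2}) \<and> card (S2 z) = g) \<and>
     disjoint_family_on (case_sum S1 S2) (S <+> S) \<and>
     (\<forall>z\<in>S. \<forall>x\<in>S1 z. neighbors G x \<inter> {z1, z2, z} = {z1, z}) \<and>
     (\<forall>z\<in>S. \<forall>x\<in>S2 z. neighbors G x \<inter> {z1, z2, z} = {z2, z})"

definition clear_crystal ::
  "('a, 'b) pre_digraph \<Rightarrow> 'a \<Rightarrow> 'a \<Rightarrow> nat \<Rightarrow> nat \<Rightarrow> 'a set \<Rightarrow> ('a \<Rightarrow> 'a set) \<Rightarrow> ('a \<Rightarrow> 'a set) \<Rightarrow> bool"
where
  "clear_crystal G z1 z2 f g S S1 S2 \<longleftrightarrow>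
     crystal G z1 z2 f g S S1 S2 \<and>
     stable G S \<and>
     (\<forall>z\<in>S. stable G (S1 z) \<and> stable G (S2 z)) \<and>
     pairwise (\<lambda>i j. anticomplete G (case_sum S1 S2 i) (case_sum S1 S2 j)) (S <+> S)"

end

theory Submission
  imports Defs
begin

text \<open>
  For each centre \<open>z\<close>, match \<open>\<Lambda>\<^sub>1\<^sub>,\<^sub>z\<close> with \<open>\<Lambda>\<^sub>2\<^sub>,\<^sub>z\<close> and choose \<open>2g\<close> pairwise anticomplete matched pairs.
  The first ends of \<open>g\<close> of them and the second ends of the other \<open>g\<close> are stable sets that are
  anticomplete to each other. Together with \<open>z\<close> they form a set of size \<open>2g + 1\<close>; among these sets,
  one for each \<open>z\<close>, choose \<open>f\<close> that are pairwise anticomplete.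
\<close>

lemma pairwise_subfamily:
  assumes sel: "\<And>\<X>. \<lbrakk>\<forall>X\<in>\<X>. Q X; disjoint \<X>; card \<X> \<ge> N\<rbrakk>
      \<Longrightarrow> \<exists>\<Y>. \<Y> \<subseteq> \<X> \<and> card \<Y> = q \<and> pairwise R \<Y>"
    and dis: "disjoint_family_on P I"
    and P: "\<And>i. i \<in> I \<Longrightarrow> P i \<noteq> {} \<and> Q (P i)"
    and N: "card I \<ge> N"
  obtains T where "T \<subseteq> I" "card T = q" "pairwise (\<lambda>i j. R (P i) (P j)) T"
proof -
  have inj: "inj_on P I"
    using dis P unfolding inj_on_def disjoint_family_on_def by (metis Int_absorb)
  have "\<forall>X \<in> P ` I. Q X" "disjoint (P ` I)" "card (P ` I) \<ge> N"
    using P dis N inj by (auto simp: disjoint_family_on_disjoint_image card_image)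
  from sel[OF this] obtain \<Y> where Y: "\<Y> \<subseteq> P ` I" "card \<Y> = q" "pairwise R \<Y>" by blast
  \<comment> \<open>One index per selected set: injectivity of \<open>P\<close> on \<open>T\<close>
    preserves the count \<open>q\<close> and turns different indices into different members of
    \<open>\<Y>\<close>.\<close>
  from Y(1) obtain T where T: "T \<subseteq> I" "inj_on P T" "\<Y> = P ` T"
    by (auto simp: subset_image_inj)
  show thesis
  proof (rule that[OF T(1)])
    show "card T = q" using T Y by (simp add: card_image)
    show "pairwise (\<lambda>i j. R (P i) (P j)) T"
      using Y(3) T(2) unfolding T(3)
      by (metis (mono_tags, lifting) imageI inj_onD pairwise_def)
  qed
qed

lemma anticomplete_mono:
  "\<lbrakk>anticomplete G X Y; X' \<subseteq> X; Y' \<subseteq> Y\<rbrakk> \<Longrightarrow> anticomplete G X' Y'"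
  by (auto simp: anticomplete_def)

lemma disjoint_family_on_case_sumD:
  assumes "disjoint_family_on (case_sum A B) (I <+> J)"
  shows "disjoint_family_on A I" "disjoint_family_on B J" "\<lbrakk>i \<in> I; j \<in> J\<rbrakk> \<Longrightarrow> A i \<inter> B j = {}"
proof -
  have dis: "case_sum A B x \<inter> case_sum A B y = {}" if "x \<in> I <+> J" "y \<in> I <+> J" "x \<noteq> y" for x y
    using assms that by (simp add: disjoint_family_on_def)
  show "disjoint_family_on A I"
    using dis[of "Inl i" "Inl j" for i j] by (simp add: disjoint_family_on_def Plus_def)
  show "disjoint_family_on B J"
    using dis[of "Inr i" "Inr j" for i j] by (simp add: disjoint_family_on_def Plus_def)
  show "A i \<inter> B j = {}" if "i \<in> I" "j \<in> J"
    using dis[of "Inl i" "Inr j"] that by (simp add: Plus_def)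
qed

text \<open>Vertices chosen from different sets are nonadjacent by anticompleteness; a single index
  yields a single vertex, which has no loop. Edges inside one \<open>P a\<close> do no harm.\<close>

lemma (in loopfree_digraph) stable_transversal:
  assumes "pairwise (\<lambda>a b. anticomplete G (P a) (P b)) T" "\<And>a. a \<in> T \<Longrightarrow> k a \<in> P a"
  shows "stable G (k ` T)"
  unfolding stable_def
proof (intro ballI)
  fix x y assume "x \<in> k ` T" "y \<in> k ` T"
  then obtain a b where ab: "a \<in> T" "x = k a" "b \<in> T" "y = k b" by auto
  show "\<not> x \<rightarrow>\<^bsub>G\<^esub> y"
  proof (cases "a = b")
    case True then show ?thesis using ab adj_not_same by auto
  next
    case False
    then show ?thesis using assms ab by (auto simp: pairwise_def anticomplete_def)
  qed
qed

lemma (in loopfree_digraph) stable_split_pairs: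
  fixes g :: nat
  assumes sel: "\<And>\<X>. \<lbrakk>\<forall>X\<in>\<X>. X \<subseteq> verts G \<and> card X \<le> 2; disjoint \<X>; card \<X> \<ge> N\<rbrakk>
      \<Longrightarrow> \<exists>\<Y>. \<Y> \<subseteq> \<X> \<and> card \<Y> = 2 * g \<and> pairwise (anticomplete G) \<Y>"
    and A: "A \<subseteq> verts G" "card A = N" and B: "B \<subseteq> verts G" "card B = N"
    and fin: "finite A" "finite B" and AB: "A \<inter> B = {}"
  shows "\<exists>A' B'. A' \<subseteq> A \<and> B' \<subseteq> B \<and> card A' = g \<and> card B' = g \<and>
      stable G A' \<and> stable G B' \<and> anticomplete G A' B' \<and> anticomplete G B' A'"
proof -
  obtain h where h: "bij_betw h A B"
    using fin A B by (metis finite_same_card_bij)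
  then have hB: "h a \<in> B" if "a \<in> A" for a using that by (auto simp: bij_betw_def)
  define P where "P a = {a, h a}" for a
  have dis: "disjoint_family_on P A"
    unfolding disjoint_family_on_def
  proof (intro ballI impI)
    fix a b assume ab: "a \<in> A" "b \<in> A" "a \<noteq> b"
    then have "h a \<noteq> h b" using h by (auto simp: bij_betw_def dest: inj_onD)
    \<comment> \<open>A first end of one pair cannot be a second end of another, because
      \<open>A\<close> and \<open>B\<close> are disjoint.\<close>
    moreover have "a \<noteq> h b" "b \<noteq> h a" using ab hB AB by blast+
    ultimately show "P a \<inter> P b = {}" using ab(3) by (auto simp: P_def)
  qed
  obtain T where T: "T \<subseteq> A" "card T = 2 * g"
    "pairwise (\<lambda>a b. anticomplete G (P a) (P b)) T"
  proof (rule pairwise_subfamily[OF sel dis])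
    show "P a \<noteq> {} \<and> P a \<subseteq> verts G \<and> card (P a) \<le> 2" if "a \<in> A" for a
      using that hB A B by (auto simp: P_def card_insert_if)
  qed (use A in auto)
  \<comment> \<open>An edge may join \<open>a\<close> to \<open>h a\<close>, so each selected pair
    contributes only one end: the first for indices in \<open>C\<close>, the second for those in
    \<open>D\<close>. This is why \<open>2 * g\<close> pairs are selected.\<close>
  obtain C where C: "C \<subseteq> T" "card C = g"
    using T(2) obtain_subset_with_card_n[of g T] by auto
  define D where "D = T - C"
  have finC: "finite C" using C T fin by (meson finite_subset)
  have D: "D \<subseteq> T" "card D = g" "C \<inter> D = {}"
    using C T(2) finC by (auto simp: D_def card_Diff_subset)
  have anti: "anticomplete G (P a) (P b)" if "a \<in> T" "b \<in> T" "a \<noteq> b" for a b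
    using T(3) that by (auto simp: pairwise_def)
  show ?thesis
  proof (intro exI conjI)
    show "C \<subseteq> A" "card C = g" using C T by auto
    show "h ` D \<subseteq> B" using D T hB by auto
    have "inj_on h D" using h D T by (meson bij_betw_def inj_on_subset)
    then show "card (h ` D) = g" using D by (simp add: card_image)
    show "stable G C"
      using stable_transversal[of P C "\<lambda>a. a"] pairwise_subset[OF T(3) C(1)] by (simp add: P_def)
    show "stable G (h ` D)"
      using stable_transversal[OF pairwise_subset[OF T(3) D(1)]] by (simp add: P_def)
    have CD: "anticomplete G (P c) (P d)" "anticomplete G (P d) (P c)" if "c \<in> C" "d \<in> D" for c d
      using anti[of c d] anti[of d c] that C(1) D(1,3) by auto
    then show "anticomplete G C (h ` D)" "anticomplete G (h ` D) C"
      by (auto simp: anticomplete_def P_def)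
  qed
qed

text \<open>Apart from the prescribed sizes, every crystal condition survives shrinking: adjacency
  is tested vertex by vertex, disjointness passes to subsets, and fewer centres only enlarge the set
  of vertices allowed in \<open>S1 z\<close> and \<open>S2 z\<close>.\<close>

lemma crystal_subset:
  assumes cr: "crystal G z1 z2 m k L L1 L2"
    and S: "S \<subseteq> L" "card S = f"
    and S12: "\<And>z. z \<in> S \<Longrightarrow> S1 z \<subseteq> L1 z \<and> S2 z \<subseteq> L2 z \<and> card (S1 z) = g \<and> card (S2 z) = g"
  shows "crystal G z1 z2 f g S S1 S2"
proof -
  have nb: "neighbors G x \<inter> {z1, z2, z} = {z1, z}" if "z \<in> L" "x \<in> L1 z" for x z
    using cr that by (simp add: crystal_def)
  have nb': "neighbors G x \<inter> {z1, z2, z} = {z2, z}" if "z \<in> L" "x \<in> L2 z" for x z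
    using cr that by (simp add: crystal_def)
  have vt: "L1 z \<subseteq> verts G - (L \<union> {z1, z2})" "L2 z \<subseteq> verts G - (L \<union> {z1, z2})" if "z \<in> L" for z
    using cr that by (simp_all add: crystal_def)
  have sub: "z \<in> L" "S1 z \<subseteq> L1 z" "S2 z \<subseteq> L2 z" if "z \<in> S" for z
    using that S(1) S12 by auto
  have "disjoint_family_on (case_sum L1 L2) (L <+> L)" using cr by (simp add: crystal_def)
  then have "disjoint_family_on (case_sum L1 L2) (S <+> S)"
    using S by (elim disjoint_family_on_mono[rotated]) auto
  moreover have "case_sum S1 S2 i \<subseteq> case_sum L1 L2 i" if "i \<in> S <+> S" for i
    using that by (auto dest!: S12)
  ultimately have "disjoint_family_on (case_sum S1 S2) (S <+> S)"
    by (simp add: disjoint_family_on_def) (metis (no_types, lifting) Int_mono subset_empty)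
  moreover have "S \<subseteq> verts G - {z1, z2}" using cr S by (auto simp: crystal_def)
  moreover have "S1 z \<subseteq> verts G - (S \<union> {z1, z2})" "S2 z \<subseteq> verts G - (S \<union> {z1, z2})" if "z \<in> S" for z
    using vt[OF sub(1)[OF that]] sub(2,3)[OF that] S(1) by blast+
  moreover have "neighbors G x \<inter> {z1, z2, z} = {z1, z}" if "z \<in> S" "x \<in> S1 z" for x z
    using nb sub that by (meson subsetD)
  moreover have "neighbors G x \<inter> {z1, z2, z} = {z2, z}" if "z \<in> S" "x \<in> S2 z" for x z
    using nb' sub that by (meson subsetD)
  ultimately show ?thesis
    using S(2) S12 by (simp add: crystal_def)
qed

theorem theorem2p6:
  fixes G :: "('a, 'b) pre_digraph"
    and n :: "nat \<Rightarrow> nat \<Rightarrow> nat \<Rightarrow> nat \<Rightarrow> nat"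
    and f g s t :: nat
    and z1 z2 :: 'a
    and L :: "'a set" and L1 L2 :: "'a \<Rightarrow> 'a set"
  assumes n_pos: "\<And>q r s t. \<lbrakk>q \<ge> 1; r \<ge> 1; s \<ge> 1; t \<ge> 1\<rbrakk> \<Longrightarrow> n q r s t \<ge> 1"
    and n_prop: "\<And>q r s t (H :: ('a, 'b) pre_digraph) (\<X> :: 'a set set).
      \<lbrakk>q \<ge> 1; r \<ge> 1; s \<ge> 1; t \<ge> 1; graph H;
       induced_free (complete_bipartite_digraph s s) H; induced_free (complete_digraph t) H;
       \<forall>X\<in>\<X>. X \<subseteq> verts H \<and> card X \<le> r; disjoint \<X>; card \<X> \<ge> n q r s t\<rbrakk>
      \<Longrightarrow> \<exists>\<Y>. \<Y> \<subseteq> \<X> \<and> card \<Y> = q \<and> pairwise (anticomplete H) \<Y>"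
    and "f \<ge> 1" "g \<ge> 1" "s \<ge> 1" "t \<ge> 1"
    and "graph G"
    and "induced_free (complete_bipartite_digraph s s) G"
    and "induced_free (complete_digraph t) G"
    and "z1 \<in> verts G" "z2 \<in> verts G" "z1 \<rightarrow>\<^bsub>G\<^esub> z2"
    and "crystal G z1 z2 (n f (2 * g + 1) s t) (n (2 * g) 2 s t) L L1 L2"
  shows "\<exists>S S1 S2. clear_crystal G z1 z2 f g S S1 S2"
proof -
  interpret graph G by fact
  define n1 where "n1 = n f (2 * g + 1) s t"
  define n2 where "n2 = n (2 * g) 2 s t"
  have cr: "crystal G z1 z2 n1 n2 L L1 L2" using assms by (simp add: n1_def n2_def)
  \<comment> \<open>Infinite sets have \<open>card\<close> 0, so positivity of \<open>n2\<close>
    makes the sets \<open>L1 z\<close> and \<open>L2 z\<close> finite.\<close>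
  have n2: "n2 \<ge> 1" unfolding n2_def using assms by (intro n_pos) auto
  have L: "L \<subseteq> verts G" "card L = n1" using cr by (auto simp: crystal_def)
  have L12: "L1 z \<subseteq> verts G - L" "L2 z \<subseteq> verts G - L" "card (L1 z) = n2" "card (L2 z) = n2"
    if "z \<in> L" for z
    using cr that by (auto simp: crystal_def)
  have dis: "disjoint_family_on L1 L" "disjoint_family_on L2 L"
    "\<And>y z. \<lbrakk>y \<in> L; z \<in> L\<rbrakk> \<Longrightarrow> L1 y \<inter> L2 z = {}"
    using cr disjoint_family_on_case_sumD[of L1 L2 L L] by (simp_all add: crystal_def)
  have sel2: "\<exists>\<Y>. \<Y> \<subseteq> \<X> \<and> card \<Y> = 2 * g \<and> pairwise (anticomplete G) \<Y>"
    if "\<forall>X\<in>\<X>. X \<subseteq> verts G \<and> card X \<le> 2" "disjoint \<X>" "card \<X> \<ge> n2" for \<X>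
    by (rule n_prop[where r = 2 and s = s and t = t]) (use that assms in \<open>auto simp: n2_def\<close>)
  have sel1: "\<exists>\<Y>. \<Y> \<subseteq> \<X> \<and> card \<Y> = f \<and> pairwise (anticomplete G) \<Y>"
    if "\<forall>X\<in>\<X>. X \<subseteq> verts G \<and> card X \<le> 2 * g + 1" "disjoint \<X>" "card \<X> \<ge> n1" for \<X>
    by (rule n_prop[where r = "2 * g + 1" and s = s and t = t])
      (use that assms in \<open>auto simp: n1_def\<close>)
  have "\<forall>z\<in>L. \<exists>A B. A \<subseteq> L1 z \<and> B \<subseteq> L2 z \<and> card A = g \<and> card B = g \<and>
      stable G A \<and> stable G B \<and> anticomplete G A B \<and> anticomplete G B A"
  proof
    fix z assume z: "z \<in> L"
    show "\<exists>A B. A \<subseteq> L1 z \<and> B \<subseteq> L2 z \<and> card A = g \<and> card B = g \<and>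
      stable G A \<and> stable G B \<and> anticomplete G A B \<and> anticomplete G B A"
    proof (rule stable_split_pairs[OF sel2])
      show "finite (L1 z)" "finite (L2 z)"
        using L12[OF z] n2 card_ge_0_finite by force+
    qed (use L12[OF z] dis z in auto)
  qed
  then obtain S1 S2 where S12: "\<And>z. z \<in> L \<Longrightarrow> S1 z \<subseteq> L1 z \<and> S2 z \<subseteq> L2 z \<and>
      card (S1 z) = g \<and> card (S2 z) = g \<and> stable G (S1 z) \<and> stable G (S2 z) \<and>
      anticomplete G (S1 z) (S2 z) \<and> anticomplete G (S2 z) (S1 z)"
    by metis
  \<comment> \<open>The centre is included so that anticompleteness of these sets also separates the
    centres from each other. The edges from \<open>z\<close> to its own \<open>S1 z\<close> and
    \<open>S2 z\<close> stay inside \<open>X z\<close>, where they are allowed.\<close>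
  define X where "X z = insert z (S1 z \<union> S2 z)" for z
  have disX: "disjoint_family_on X L"
    unfolding disjoint_family_on_def
  proof (intro ballI impI)
    fix y z assume yz: "y \<in> L" "z \<in> L" "y \<noteq> z"
    have "L1 y \<inter> L1 z = {}" "L2 y \<inter> L2 z = {}"
      using dis(1,2) yz by (auto simp: disjoint_family_on_def)
    \<comment> \<open>Overlaps on one side or across sides are excluded by disjointness of the
      original family; a centre cannot lie in a set of another centre, as those sets avoid
      \<open>L\<close>.\<close>
    then show "X y \<inter> X z = {}"
      using yz S12[OF yz(1)] S12[OF yz(2)] L12(1,2)[OF yz(1)] L12(1,2)[OF yz(2)]
        dis(3)[OF yz(1,2)] dis(3)[OF yz(2,1)]
      unfolding X_def by blast
  qed
  obtain S where S: "S \<subseteq> L" "card S = f" "pairwise (\<lambda>y z. anticomplete G (X y) (X z)) S"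
  proof (rule pairwise_subfamily[OF sel1 disX])
    fix z assume z: "z \<in> L"
    have "card (S1 z \<union> S2 z) \<le> 2 * g"
      using card_Un_le[of "S1 z" "S2 z"] S12[OF z] by simp
    then have "card (X z) \<le> 2 * g + 1"
      unfolding X_def using card_insert_le_m1[of "2 * g + 1"] by simp
    moreover have "X z \<subseteq> verts G"
      using S12[OF z] L12(1,2)[OF z] L(1) z unfolding X_def by blast
    ultimately show "X z \<noteq> {} \<and> X z \<subseteq> verts G \<and> card (X z) \<le> 2 * g + 1"
      by (simp add: X_def)
  qed (use L in auto)
  have "clear_crystal G z1 z2 f g S S1 S2"
    unfolding clear_crystal_def
  proof (intro conjI)
    show "crystal G z1 z2 f g S S1 S2"
      by (rule crystal_subset[OF cr S(1,2)]) (use S(1) S12 in blast)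
    \<comment> \<open>The centres form a transversal of the selected sets, since \<open>z\<close>
      lies in \<open>X z\<close>.\<close>
    show "stable G S"
      using stable_transversal[OF S(3), of "\<lambda>z. z"] by (simp add: X_def)
    show "\<forall>z\<in>S. stable G (S1 z) \<and> stable G (S2 z)" using S S12 by auto
    have sub: "S1 z \<subseteq> X z" "S2 z \<subseteq> X z" for z by (auto simp: X_def)
    have far: "anticomplete G A B" if "y \<in> S" "z \<in> S" "y \<noteq> z" "A \<subseteq> X y" "B \<subseteq> X z" for y z A B
      using anticomplete_mono[OF pairwiseD[OF S(3) that(1-3)] that(4,5)] .
    have near: "anticomplete G (S1 z) (S2 z)" "anticomplete G (S2 z) (S1 z)" if "z \<in> S" for z
      using that S S12 by auto
    \<comment> \<open>Sets on opposite sides may share their centre: then the split of the pairs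
      applies (\<open>near\<close>), otherwise the selection of centres (\<open>far\<close>).
      Different indices on the same side always have different centres, so there \<open>far\<close>
      is enough.\<close>
    have "anticomplete G (S1 y) (S2 z)" "anticomplete G (S2 y) (S1 z)" if "y \<in> S" "z \<in> S" for y z
      using that near far[OF that _ sub(1) sub(2)] far[OF that _ sub(2) sub(1)]
      by (cases "y = z"; simp)+
    then show "pairwise (\<lambda>i j. anticomplete G (case_sum S1 S2 i) (case_sum S1 S2 j)) (S <+> S)"
      using far[OF _ _ _ sub(1) sub(1)] far[OF _ _ _ sub(2) sub(2)]
      by (auto simp: pairwise_def; blast)
  qed
  then show ?thesis by blast
qed

end
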